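(* For every integer $n\ge 1$, $$\sum_{\substack{t\ge 1,\ k_1+\dots+k_t=n\\ k_1,\dots,k_t\ge 2}}\frac{n!}{k_1!\cdots k_t!}\,(k_1-1)\cdots(k_t-1)={!n},$$ where the sum is over all ordered tuples $(k_1,\dots,k_t)$ of integers $\ge 2$ with sum $n$ (of any length $t\ge1$), and $!n$ is the number of derangements of $n$ objects (permutations without fixed points).
   Context: An empty sum is $0$. *)

theory Defs
  imports Complex_Main "HOL-Combinatorics.Permutations"
begin

definition derangements :: "'a set \<Rightarrow> ('a \<Rightarrow> 'a) set" where
  "derangements A = {p. p permutes A \<and> (\<forall>x\<in>A. p x \<noteq> x)}"

definition subfactorial :: "nat \<Rightarrow> nat" where
  "subfactorial n = card (derangements {1..n})"

definition compositions_ge2 :: "nat \<Rightarrow> nat list set" where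
  "compositions_ge2 n = {ks. length ks \<ge> 1 \<and> (\<forall>k\<in>set ks. k \<ge> 2) \<and> sum_list ks = n}"

(* A sum over an infinite set is 0 by convention in HOL, and so is the cardinality of
   an infinite set; the next two lemmas rule out both artefacts. *)

lemma finite_compositions_ge2: "finite (compositions_ge2 n)"
proof (rule finite_subset)
  have len: "length ks \<le> sum_list ks" if "\<forall>k\<in>set ks. k \<ge> 2" for ks :: "nat list"
    using that by (induction ks) auto
  show "compositions_ge2 n \<subseteq> {ks. set ks \<subseteq> {..n} \<and> length ks \<le> n}"
    using len member_le_sum_list by (fastforce simp: compositions_ge2_def)
  show "finite {ks. set ks \<subseteq> {..n} \<and> length ks \<le> n}"
    by (rule finite_lists_length_le) simp
qed

lemma finite_derangements: "finite A \<Longrightarrow> finite (derangements A)"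
  by (rule finite_subset[OF _ finite_permutations]) (auto simp: derangements_def)

end

(* The tuples of length t contribute G^t, where G = \<Sum>_{k\<ge>2} (k-1) x^k / k! = 1 - (1-x) e^x, so the
   exponential generating function of the left-hand side is 1 / (1 - G) = e^(-x) / (1-x).
   Multiplying by e^x gives \<Sum>_k binom(n,k) a(k) = n! for its values a(n). Sorting permutations
   by their set of non-fixed points shows that the derangement numbers satisfy the same recurrence,
   which determines them. *)

theory Submission
  imports Defs "HOL-Computational_Algebra.Formal_Power_Series"
begin

unbundle fps_syntax

text \<open>Unlike \<open>compositions_ge2\<close>, this admits the empty tuple. It supplies the
  constant term 1 of the geometric series 1 / (1 - G), which starts at G^0.\<close>

definition compositions_in :: "nat set \<Rightarrow> nat \<Rightarrow> nat list set" where
  "compositions_in K n = {ks. set ks \<subseteq> K \<and> sum_list ks = n}"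

lemma finite_compositions_in:
  assumes "0 \<notin> K"
  shows "finite (compositions_in K n)"
proof (rule finite_subset)
  have len: "length ks \<le> sum_list ks" if "set ks \<subseteq> K" for ks
    using that
  proof (induction ks)
    case (Cons k ks)
    then have "k > 0" using assms by (cases k) auto
    with Cons show ?case by simp
  qed simp
  show "compositions_in K n \<subseteq> {ks. set ks \<subseteq> {..n} \<and> length ks \<le> n}"
    using len member_le_sum_list by (fastforce simp: compositions_in_def)
  show "finite {ks. set ks \<subseteq> {..n} \<and> length ks \<le> n}"
    by (rule finite_lists_length_le) simp
qed

lemma compositions_in_0:
  assumes "0 \<notin> K"
  shows "compositions_in K 0 = {[]}"
proof -
  have "ks = []" if "set ks \<subseteq> K" "sum_list ks = 0" for ks
    using that assms by (cases ks) auto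
  then show ?thesis by (auto simp: compositions_in_def)
qed

lemma compositions_in_rec:
  assumes "n > 0"
  shows "compositions_in K n =
    (\<Union>k\<in>{k\<in>K. k \<le> n}. (#) k ` compositions_in K (n - k))"
proof (intro equalityI subsetI)
  fix ks assume "ks \<in> compositions_in K n"
  with assms show "ks \<in> (\<Union>k\<in>{k\<in>K. k \<le> n}. (#) k ` compositions_in K (n - k))"
    by (cases ks) (auto simp: compositions_in_def)
qed (auto simp: compositions_in_def)

text \<open>Splitting off the first part \<open>k\<close> sorts the tuples into disjoint classes,
  and the weight is multiplicative, so \<open>g k\<close> factors out of each class.\<close>

lemma sum_compositions_in_rec:
  fixes g :: "nat \<Rightarrow> 'a :: comm_semiring_1"
  assumes "0 \<notin> K" "n > 0"
  shows "(\<Sum>ks\<in>compositions_in K n. prod_list (map g ks)) =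
    (\<Sum>k | k \<in> K \<and> k \<le> n. g k * (\<Sum>ks\<in>compositions_in K (n - k). prod_list (map g ks)))"
proof -
  have "(\<Sum>ks\<in>compositions_in K n. prod_list (map g ks)) =
    (\<Sum>k | k \<in> K \<and> k \<le> n. \<Sum>ks\<in>(#) k ` compositions_in K (n - k). prod_list (map g ks))"
    unfolding compositions_in_rec[OF assms(2)]
    by (rule sum.UNION_disjoint) (auto simp: finite_compositions_in[OF assms(1)])
  also have "\<dots> = (\<Sum>k | k \<in> K \<and> k \<le> n.
      g k * (\<Sum>ks\<in>compositions_in K (n - k). prod_list (map g ks)))"
    by (simp add: sum.reindex sum_distrib_left)
  finally show ?thesis .
qed

text \<open>The recursion on the first part says F = 1 + G F. This replaces summing the powers of G,
  so no infinite sum of series has to be handled.\<close>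

lemma fps_compositions_in:
  fixes g :: "nat \<Rightarrow> 'a :: comm_ring_1"
  assumes "0 \<notin> K"
  shows "(1 - Abs_fps (\<lambda>k. if k \<in> K then g k else 0)) *
    Abs_fps (\<lambda>n. \<Sum>ks\<in>compositions_in K n. prod_list (map g ks)) = 1"
    (is "(1 - ?G) * ?F = 1")
proof -
  have "?F = 1 + ?G * ?F"
  proof (rule fps_ext)
    fix n
    show "?F $ n = (1 + ?G * ?F) $ n"
    proof (cases "n = 0")
      case True
      then show ?thesis using assms by (simp add: compositions_in_0)
    next
      case False
      have "(?G * ?F) $ n = (\<Sum>k\<in>{0..n}. if k \<in> K
          then g k * (\<Sum>ks\<in>compositions_in K (n - k). prod_list (map g ks)) else 0)"
        by (auto simp: fps_mult_nth intro!: sum.cong)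
      also have "\<dots> = (\<Sum>k | k \<in> K \<and> k \<le> n.
          g k * (\<Sum>ks\<in>compositions_in K (n - k). prod_list (map g ks)))"
        by (rule sum.mono_neutral_cong_right) auto
      finally show ?thesis
        using False sum_compositions_in_rec[OF assms, of n g] by simp
    qed
  qed
  then show ?thesis by (simp add: algebra_simps)
qed

text \<open>For k \<ge> 1, (k - 1) / k! = 1 / (k - 1)! - 1 / k! is the coefficient of x^k in x e^x -
  e^x. It vanishes at k = 1, and the constant term -1 of that series is offset by the leading
  1.\<close>

lemma fps_pred_over_fact:
  "1 - Abs_fps (\<lambda>k. if k \<in> {2..} then (real k - 1) / fact k else 0) = (1 - fps_X) * fps_exp 1"
proof (rule fps_ext)
  fix n
  show "(1 - Abs_fps (\<lambda>k. if k \<in> {2..} then (real k - 1) / fact k else 0)) $ n =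
    ((1 - fps_X) * fps_exp 1) $ n"
  proof (cases n)
    case (Suc m)
    have "1 / fact m = real n / fact n"
      using Suc by (simp add: field_simps del: of_nat_Suc)
    with Suc show ?thesis
      by (cases m) (simp_all add: left_diff_distrib add_divide_distrib del: fact_Suc)
  qed (simp add: algebra_simps)
qed

lemma one_minus_fps_X_mult_Abs_fps_one:
  "(1 - fps_X) * Abs_fps (\<lambda>_. 1) = (1 :: 'a :: comm_ring_1 fps)"
proof (rule fps_ext)
  fix n show "((1 - fps_X) * Abs_fps (\<lambda>_. 1)) $ n = (1 :: 'a fps) $ n"
    by (cases n) (simp_all add: algebra_simps)
qed

text \<open>For \<open>n\<close> \<ge> 1 this is the sum of the theorem divided by n!; at
  \<open>n\<close> = 0 the empty tuple gives 1, matching the one derangement of the empty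
  set.\<close>

definition weighted_compositions :: "nat \<Rightarrow> real" where
  "weighted_compositions n =
    (\<Sum>ks\<in>compositions_in {2..} n. prod_list (map (\<lambda>k. (real k - 1) / fact k) ks))"

lemma binomial_sum_weighted_compositions:
  "(\<Sum>k\<le>n. real (n choose k) * (fact k * weighted_compositions k)) = fact n"
proof -
  let ?F = "Abs_fps weighted_compositions" and ?E = "fps_exp (1::real)"
  have "(1 - fps_X) * ?E * ?F = 1"
    using fps_compositions_in[of "{2..}" "\<lambda>k. (real k - 1) / fact k"] fps_pred_over_fact
    by (simp add: weighted_compositions_def[abs_def])
  \<comment> \<open>Both sides equal 1. Cancelling 1 - x leaves F e^x = 1 / (1 - x), whose
    coefficients are all 1.\<close>
  then have "(1 - fps_X) * (?F * ?E) = (1 - fps_X) * Abs_fps (\<lambda>_. 1)"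
    using one_minus_fps_X_mult_Abs_fps_one[where 'a = real] by (simp add: mult_ac)
  moreover have "(1 - fps_X :: real fps) \<noteq> 0"
    by (metis fps_X_nth fps_one_nth fps_sub_nth fps_zero_nth diff_zero zero_neq_one)
  ultimately have "?F * ?E = Abs_fps (\<lambda>_. 1)"
    by simp
  then have "(?F * ?E) $ n = 1"
    by simp
  then have "fact n = fact n * (\<Sum>k\<in>{0..n}. weighted_compositions k / fact (n - k))"
    by (simp add: fps_mult_nth)
  also have "\<dots> = (\<Sum>k\<le>n. real (n choose k) * (fact k * weighted_compositions k))"
    by (auto simp: sum_distrib_left atMost_atLeast0 binomial_fact intro!: sum.cong)
  finally show ?thesis by simp
qed

lemma permutes_eq_UN_derangements:
  "{p. p permutes A} = (\<Union>S\<in>Pow A. derangements S)"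
proof (intro equalityI subsetI)
  fix p assume "p \<in> {p. p permutes A}"
  then have p: "p permutes A" by simp
  then have "p permutes {x\<in>A. p x \<noteq> x}"
    by (rule permutes_superset) auto
  then show "p \<in> (\<Union>S\<in>Pow A. derangements S)"
    by (auto simp: derangements_def)
next
  fix p assume "p \<in> (\<Union>S\<in>Pow A. derangements S)"
  then show "p \<in> {p. p permutes A}"
    by (auto simp: derangements_def intro: permutes_subset)
qed

text \<open>A derangement determines its set: \<open>permutes\<close> forces the identity outside
  \<open>S\<close>, so \<open>S\<close> is exactly the set of points that \<open>p\<close>
  moves.\<close>

lemma derangements_disjoint:
  assumes "S \<noteq> T"
  shows "derangements S \<inter> derangements T = {}"
proof -
  have "S = {x. p x \<noteq> x}" if "p \<in> derangements S" for p and S :: "'a set"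
    using that by (auto simp: derangements_def permutes_def)
  with assms show ?thesis by blast
qed

lemma sum_card_derangements:
  assumes "finite A"
  shows "(\<Sum>S\<in>Pow A. card (derangements S)) = fact (card A)"
proof -
  have "fact (card A) = card (\<Union>S\<in>Pow A. derangements S)"
    using assms by (simp add: card_permutations flip: permutes_eq_UN_derangements)
  also have "\<dots> = (\<Sum>S\<in>Pow A. card (derangements S))"
    using assms
    by (intro card_UN_disjoint)
       (auto simp: derangements_disjoint intro!: finite_derangements intro: finite_subset)
  finally show ?thesis by simp
qed

lemma sum_Pow_card:
  fixes f :: "nat \<Rightarrow> 'b :: semiring_1"
  assumes "finite A"
  shows "(\<Sum>S\<in>Pow A. f (card S)) = (\<Sum>k\<le>card A. of_nat (card A choose k) * f k)"
proof -
  have "(\<Sum>S\<in>Pow A. f (card S)) = (\<Sum>k\<le>card A. \<Sum>S\<in>{S\<in>Pow A. card S = k}. f (card S))"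
    using assms by (intro sum.group[symmetric]) (auto intro: card_mono)
  also have "\<dots> = (\<Sum>k\<le>card A. of_nat (card A choose k) * f k)"
    using assms by (simp flip: n_subsets)
  finally show ?thesis .
qed

text \<open>The counts and the values of \<open>d\<close> have the same total over all subsets of
  \<open>A\<close>, namely (card A)!. By induction they agree on every proper subset, hence also on
  \<open>A\<close>.\<close>

lemma card_derangements:
  assumes "finite A"
    and d: "\<And>n. (\<Sum>k\<le>n. real (n choose k) * d k) = fact n"
  shows "real (card (derangements A)) = d (card A)"
  using assms(1)
proof (induction A rule: finite_psubset_induct)
  case (psubset A)
  have split: "(\<Sum>S\<in>Pow A. f S) = f A + (\<Sum>S\<in>Pow A - {A}. f S)" for f :: "'a set \<Rightarrow> real"
    using psubset.hyps by (intro sum.remove) auto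
  have "(\<Sum>S\<in>Pow A. real (card (derangements S))) = (\<Sum>S\<in>Pow A. d (card S))"
    using sum_card_derangements[OF psubset.hyps] sum_Pow_card[OF psubset.hyps, of d] d
    by (metis of_nat_fact of_nat_sum)
  moreover have "(\<Sum>S\<in>Pow A - {A}. real (card (derangements S))) =
      (\<Sum>S\<in>Pow A - {A}. d (card S))"
    by (intro sum.cong psubset.IH) auto
  ultimately show ?case
    by (simp add: split)
qed

theorem mainTheorem5:
  fixes n :: nat
  assumes "n \<ge> 1"
  shows "(\<Sum>ks\<in>compositions_ge2 n.
            fact n / (\<Prod>i<length ks. fact (ks ! i)) * (\<Prod>i<length ks. real (ks ! i) - 1))
         = real (subfactorial n)"
proof -
  \<comment> \<open>Since \<open>n\<close> \<ge> 1, the empty tuple does not have sum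
    \<open>n\<close>, so allowing it in \<open>compositions_in\<close> adds nothing here.\<close>
  have ne: "ks \<noteq> []" if "sum_list ks = n" for ks
    using that assms by auto
  have "compositions_ge2 n = compositions_in {2..} n"
    using ne by (auto simp: compositions_ge2_def compositions_in_def Suc_le_eq)
  moreover have "prod_list (map (\<lambda>k. (real k - 1) / fact k) ks) =
      (\<Prod>i<length ks. real (ks ! i) - 1) / (\<Prod>i<length ks. fact (ks ! i))" for ks
    by (simp add: prod.list_conv_set_nth atLeast0LessThan prod_dividef)
  ultimately have "(\<Sum>ks\<in>compositions_ge2 n.
      fact n / (\<Prod>i<length ks. fact (ks ! i)) * (\<Prod>i<length ks. real (ks ! i) - 1)) =
      fact n * weighted_compositions n"
    by (simp add: weighted_compositions_def sum_distrib_left)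
  also have "\<dots> = real (subfactorial n)"
    using card_derangements[of "{1..n}" "\<lambda>k. fact k * weighted_compositions k"]
      binomial_sum_weighted_compositions
    by (simp add: subfactorial_def)
  finally show ?thesis .
qed

end
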